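(* Let $(X,\mathcal{F},\mu)$ be a measure space, $u:X\to\mathbb{C}$ a positive measurable function such that the multiplication operator $M_uf=u\cdot f$ is bounded on $L^2(\mu)$, and $m\in\mathbb{N}$. The following hold for the multiplication operator $M_u$ on $L^2(\mu)$. (i) $M_u$ is quasi-$m$-isometry if and only if $$|u(x)|^2(|u(x)|^2-1)^m=\sum_{k=0}^{m}(-1)^{m-k}\binom{m}{k}|u(x)|^{2(k+1)}=0$$ for almost all $x\in X$, or equivalently $|u|(1-|u|^2)=0$ $\mu$-a.e., if and only if $$\mu(\{x\in X:u(x)\neq 0\}\cap\{x\in X:|u(x)|\neq 1\})=0.$$ (ii) $M_u$ is $m$-isometry if and only if $$(|u(x)|^2-1)^m=\sum_{k=0}^{m}(-1)^{m-k}\binom{m}{k}|u(x)|^{2k}=0$$ for almost all $x\in X$, or equivalently $|u|=1$ $\mu$-a.e.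
   Context: A bounded operator $T$ on a complex Hilbert space is called $m$-isometry if $B_m=\sum_{k=0}^{m}(-1)^{m-k}\binom{m}{k}T^{*k}T^{k}=0$, and quasi-$m$-isometry if $T^*B_mT=\sum_{k=0}^{m}(-1)^{m-k}\binom{m}{k}T^{*(k+1)}T^{k+1}=0$.
   Formalization: The measure μ is assumed semifinite (every set of infinite measure contains a measurable subset of finite positive measure), since the claim fails for every other measure, and m is taken to be at least 1, since the equivalences fail for m = 0. *)

theory Defs
  imports "HOL-Analysis.Analysis" "HOL-Algebra.Module" "HOL-Library.Complex_Order"
begin

section \<open>Complex Hilbert spaces with explicit carriers\<close>

text \<open>
  The space $L^2(\mu)$ depends on the measure, which is a term, so it cannot be a type; Hilbert
  spaces are therefore records extending the modules of HOL-Algebra. As in other modules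
  there, the ring multiplication and unit of the record play no role. The inner product is linear
  in its first argument.
\<close>

record 'v cinner_space = "(complex, 'v) module" +
  vinner :: "'v \<Rightarrow> 'v \<Rightarrow> complex"

definition hnorm :: "('v, 'e) cinner_space_scheme \<Rightarrow> 'v \<Rightarrow> real" where
  "hnorm H x = sqrt (Re (vinner H x x))"

locale complex_inner_space = abelian_group H for H (structure) +
  assumes smult_closed: "x \<in> carrier H \<Longrightarrow> a \<odot> x \<in> carrier H"
    and smult_l_distr: "x \<in> carrier H \<Longrightarrow> (a + b) \<odot> x = a \<odot> x \<oplus> b \<odot> x"
    and smult_r_distr:
      "\<lbrakk>x \<in> carrier H; y \<in> carrier H\<rbrakk> \<Longrightarrow> a \<odot> (x \<oplus> y) = a \<odot> x \<oplus> a \<odot> y"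
    and smult_assoc: "x \<in> carrier H \<Longrightarrow> (a * b) \<odot> x = a \<odot> (b \<odot> x)"
    and smult_one: "x \<in> carrier H \<Longrightarrow> 1 \<odot> x = x"
    and vinner_add_left:
      "\<lbrakk>x \<in> carrier H; y \<in> carrier H; z \<in> carrier H\<rbrakk>
        \<Longrightarrow> vinner H (x \<oplus> y) z = vinner H x z + vinner H y z"
    and vinner_smult_left:
      "\<lbrakk>x \<in> carrier H; y \<in> carrier H\<rbrakk> \<Longrightarrow> vinner H (a \<odot> x) y = a * vinner H x y"
    and vinner_commute:
      "\<lbrakk>x \<in> carrier H; y \<in> carrier H\<rbrakk> \<Longrightarrow> vinner H y x = cnj (vinner H x y)"
    and vinner_nonneg: "x \<in> carrier H \<Longrightarrow> 0 \<le> vinner H x x"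
    and vinner_eq_zero: "\<lbrakk>x \<in> carrier H; vinner H x x = 0\<rbrakk> \<Longrightarrow> x = \<zero>"

locale complex_hilbert_space = complex_inner_space +
  assumes complete:
    "\<lbrakk>\<And>n. X n \<in> carrier H;
      \<And>e. 0 < e \<Longrightarrow> \<exists>N. \<forall>i\<ge>N. \<forall>j\<ge>N. hnorm H (X i \<ominus> X j) < e\<rbrakk>
      \<Longrightarrow> \<exists>x\<in>carrier H. (\<lambda>n. hnorm H (X n \<ominus> x)) \<longlonglongrightarrow> 0"


section \<open>Bounded operators, m-isometries and quasi-m-isometries\<close>

text \<open>Operators are only meaningful on the carrier; all equations between them are relativised to it.\<close>

definition bounded_operator :: "('v, 'e) cinner_space_scheme \<Rightarrow> ('v \<Rightarrow> 'v) \<Rightarrow> bool" where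
  "bounded_operator H T \<longleftrightarrow>
     T \<in> carrier H \<rightarrow> carrier H \<and>
     (\<forall>x\<in>carrier H. \<forall>y\<in>carrier H. T (x \<oplus>\<^bsub>H\<^esub> y) = T x \<oplus>\<^bsub>H\<^esub> T y) \<and>
     (\<forall>a. \<forall>x\<in>carrier H. T (a \<odot>\<^bsub>H\<^esub> x) = a \<odot>\<^bsub>H\<^esub> T x) \<and>
     (\<exists>C. \<forall>x\<in>carrier H. hnorm H (T x) \<le> C * hnorm H x)"

text \<open>
  The vector $T^*y$ is the one given by the Riesz representation theorem; it exists and is unique
  for bounded operators on Hilbert spaces.
\<close>

definition hadjoint :: "('v, 'e) cinner_space_scheme \<Rightarrow> ('v \<Rightarrow> 'v) \<Rightarrow> 'v \<Rightarrow> 'v" where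
  "hadjoint H T y =
     (THE z. z \<in> carrier H \<and> (\<forall>x\<in>carrier H. vinner H (T x) y = vinner H x z))"

definition isometry_defect ::
    "('v, 'e) cinner_space_scheme \<Rightarrow> ('v \<Rightarrow> 'v) \<Rightarrow> nat \<Rightarrow> 'v \<Rightarrow> 'v" where
  "isometry_defect H T m x =
     (\<Oplus>\<^bsub>H\<^esub>k\<in>{..m}. ((-1) ^ (m - k) * of_nat (m choose k)) \<odot>\<^bsub>H\<^esub> (hadjoint H T ^^ k) ((T ^^ k) x))"

definition m_isometry :: "('v, 'e) cinner_space_scheme \<Rightarrow> ('v \<Rightarrow> 'v) \<Rightarrow> nat \<Rightarrow> bool" where
  "m_isometry H T m \<longleftrightarrow>
     bounded_operator H T \<and> (\<forall>x\<in>carrier H. isometry_defect H T m x = \<zero>\<^bsub>H\<^esub>)"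

definition quasi_m_isometry :: "('v, 'e) cinner_space_scheme \<Rightarrow> ('v \<Rightarrow> 'v) \<Rightarrow> nat \<Rightarrow> bool" where
  "quasi_m_isometry H T m \<longleftrightarrow>
     bounded_operator H T \<and>
     (\<forall>x\<in>carrier H. hadjoint H T (isometry_defect H T m (T x)) = \<zero>\<^bsub>H\<^esub>)"


section \<open>The Hilbert space of square-integrable functions\<close>

definition sq_integrable :: "'a measure \<Rightarrow> ('a \<Rightarrow> complex) set" where
  "sq_integrable M = {f \<in> borel_measurable M. integrable M (\<lambda>x. (cmod (f x))\<^sup>2)}"

text \<open>The a.e.-class of a function; it is empty if the function is not equal a.e. to a
  square-integrable one.\<close>

definition ae_class :: "'a measure \<Rightarrow> ('a \<Rightarrow> complex) \<Rightarrow> ('a \<Rightarrow> complex) set" where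
  "ae_class M f = {g \<in> sq_integrable M. AE x in M. g x = f x}"

definition rep :: "('a \<Rightarrow> complex) set \<Rightarrow> 'a \<Rightarrow> complex" where
  "rep F = (SOME f. f \<in> F)"

definition L2 :: "'a measure \<Rightarrow> ('a \<Rightarrow> complex) set cinner_space" where
  "L2 M = \<lparr>carrier = ae_class M ` sq_integrable M,
           monoid.mult = undefined, one = undefined,
           zero = ae_class M (\<lambda>x. 0),
           add = (\<lambda>F G. ae_class M (\<lambda>x. rep F x + rep G x)),
           smult = (\<lambda>a F. ae_class M (\<lambda>x. a * rep F x)),
           vinner = (\<lambda>F G. LINT x|M. rep F x * cnj (rep G x))\<rparr>"

definition mult_operator ::
    "'a measure \<Rightarrow> ('a \<Rightarrow> complex) \<Rightarrow> ('a \<Rightarrow> complex) set \<Rightarrow> ('a \<Rightarrow> complex) set" where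
  "mult_operator M u F = ae_class M (\<lambda>x. u x * rep F x)"

text \<open>
  An atom of infinite measure is invisible to $L^2(\mu)$, so operator identities on $L^2(\mu)$
  determine functions $\mu$-a.e. only for semifinite measures (in particular, for sigma-finite ones).
  The locale \<open>semifinite_measure\<close> of HOL-Analysis does not ask for $\mu(B) > 0$, so it
  holds for every measure (take $B = \emptyset$).
\<close>

definition semifinite :: "'a measure \<Rightarrow> bool" where
  "semifinite M \<longleftrightarrow>
     (\<forall>A\<in>sets M. emeasure M A = \<infinity> \<longrightarrow>
        (\<exists>B\<in>sets M. B \<subseteq> A \<and> 0 < emeasure M B \<and> emeasure M B < \<infinity>))"


subsection \<open>Completeness and the other Hilbert space axioms\<close>

lemma sq_integrable_measurable: "f \<in> sq_integrable M \<Longrightarrow> f \<in> borel_measurable M"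
  by (simp add: sq_integrable_def)

lemma borel_measurable_cnj [measurable]: "cnj \<in> borel_measurable borel"
  by (intro borel_measurable_continuous_onI continuous_intros)

lemma sq_integrable_zero: "(\<lambda>x. 0) \<in> sq_integrable M"
  by (simp add: sq_integrable_def)

lemma sq_integrable_scale:
  assumes "f \<in> sq_integrable M"
  shows "(\<lambda>x. a * f x) \<in> sq_integrable M"
  using assms by (auto simp: sq_integrable_def norm_mult power_mult_distrib)

lemma sq_integrable_add:
  assumes "f \<in> sq_integrable M" "g \<in> sq_integrable M"
  shows "(\<lambda>x. f x + g x) \<in> sq_integrable M"
proof -
  have [measurable]: "f \<in> borel_measurable M" "g \<in> borel_measurable M"
    and i: "integrable M (\<lambda>x. (cmod (f x))\<^sup>2)" "integrable M (\<lambda>x. (cmod (g x))\<^sup>2)"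
    using assms by (auto simp: sq_integrable_def)
  have *: "(cmod (a + b))\<^sup>2 \<le> 2 * (cmod a)\<^sup>2 + 2 * (cmod b)\<^sup>2" for a b
  proof -
    have "(cmod (a + b))\<^sup>2 \<le> (cmod a + cmod b)\<^sup>2"
      by (intro power_mono norm_triangle_ineq) auto
    also have "\<dots> \<le> 2 * (cmod a)\<^sup>2 + 2 * (cmod b)\<^sup>2"
      using sum_squares_bound[of "cmod a" "cmod b"] by (simp add: power2_sum)
    finally show ?thesis .
  qed
  have "integrable M (\<lambda>x. 2 * (cmod (f x))\<^sup>2 + 2 * (cmod (g x))\<^sup>2)"
    using i by auto
  then have "integrable M (\<lambda>x. (cmod (f x + g x))\<^sup>2)"
    by (rule Bochner_Integration.integrable_bound) (auto simp: *)
  then show ?thesis by (simp add: sq_integrable_def)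
qed

lemma sq_integrable_diff:
  assumes "f \<in> sq_integrable M" "g \<in> sq_integrable M"
  shows "(\<lambda>x. f x - g x) \<in> sq_integrable M"
  using sq_integrable_add[OF assms(1) sq_integrable_scale[OF assms(2), of "-1"]] by simp

lemma integrable_mult_cnj:
  assumes "f \<in> sq_integrable M" "g \<in> sq_integrable M"
  shows "integrable M (\<lambda>x. f x * cnj (g x))"
proof -
  have [measurable]: "f \<in> borel_measurable M" "g \<in> borel_measurable M"
    and i: "integrable M (\<lambda>x. (cmod (f x))\<^sup>2)" "integrable M (\<lambda>x. (cmod (g x))\<^sup>2)"
    using assms by (auto simp: sq_integrable_def)
  have *: "cmod a * cmod b \<le> (cmod a)\<^sup>2 + (cmod b)\<^sup>2" for a b
    using sum_squares_bound[of "cmod a" "cmod b"] mult_nonneg_nonneg[of "cmod a" "cmod b"]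
    by (simp del: mult_nonneg_nonneg)
  have "integrable M (\<lambda>x. (cmod (f x))\<^sup>2 + (cmod (g x))\<^sup>2)"
    using i by auto
  then show ?thesis
    by (rule Bochner_Integration.integrable_bound) (auto simp: * norm_mult)
qed

lemma ae_class_eq_iff:
  assumes "f \<in> sq_integrable M" "g \<in> sq_integrable M"
  shows "ae_class M f = ae_class M g \<longleftrightarrow> (AE x in M. f x = g x)"
proof
  assume "ae_class M f = ae_class M g"
  moreover have "f \<in> ae_class M f" using assms by (simp add: ae_class_def)
  ultimately show "AE x in M. f x = g x" by (simp add: ae_class_def)
next
  assume *: "AE x in M. f x = g x"
  have "(AE x in M. h x = f x) \<longleftrightarrow> (AE x in M. h x = g x)" for h
    using * by (intro eventually_subst) (auto elim: eventually_mono)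
  then show "ae_class M f = ae_class M g" by (simp add: ae_class_def)
qed

lemma ae_class_cong:
  assumes "AE x in M. f x = g x"
  shows "ae_class M f = ae_class M g"
proof -
  have "(AE x in M. h x = f x) \<longleftrightarrow> (AE x in M. h x = g x)" for h
    using assms by (intro eventually_subst) (auto elim: eventually_mono)
  then show ?thesis by (simp add: ae_class_def)
qed

lemma
  assumes "f \<in> sq_integrable M"
  shows rep_ae_class: "AE x in M. rep (ae_class M f) x = f x"
    and rep_sq_integrable: "rep (ae_class M f) \<in> sq_integrable M"
proof -
  have "f \<in> ae_class M f" using assms by (simp add: ae_class_def)
  then have "rep (ae_class M f) \<in> ae_class M f"
    unfolding rep_def by (rule someI[where P = "\<lambda>h. h \<in> ae_class M f"])
  then show "AE x in M. rep (ae_class M f) x = f x" "rep (ae_class M f) \<in> sq_integrable M"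
    by (auto simp: ae_class_def)
qed

lemma carrier_L2: "carrier (L2 M) = ae_class M ` sq_integrable M"
  by (simp add: L2_def)

lemma zero_L2: "\<zero>\<^bsub>L2 M\<^esub> = ae_class M (\<lambda>x. 0)"
  by (simp add: L2_def)

lemma add_L2:
  assumes "f \<in> sq_integrable M" "g \<in> sq_integrable M"
  shows "ae_class M f \<oplus>\<^bsub>L2 M\<^esub> ae_class M g = ae_class M (\<lambda>x. f x + g x)"
proof -
  have "AE x in M. rep (ae_class M f) x + rep (ae_class M g) x = f x + g x"
    using rep_ae_class[OF assms(1)] rep_ae_class[OF assms(2)] by eventually_elim simp
  then show ?thesis by (simp add: L2_def ae_class_cong)
qed

lemma smult_L2:
  assumes "f \<in> sq_integrable M"
  shows "a \<odot>\<^bsub>L2 M\<^esub> ae_class M f = ae_class M (\<lambda>x. a * f x)"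
proof -
  have "AE x in M. a * rep (ae_class M f) x = a * f x"
    using rep_ae_class[OF assms(1)] by eventually_elim simp
  then show ?thesis by (simp add: L2_def ae_class_cong)
qed

lemma vinner_L2:
  assumes "f \<in> sq_integrable M" "g \<in> sq_integrable M"
  shows "vinner (L2 M) (ae_class M f) (ae_class M g) = (LINT x|M. f x * cnj (g x))"
proof -
  have [measurable]: "f \<in> borel_measurable M" "g \<in> borel_measurable M"
      "rep (ae_class M f) \<in> borel_measurable M" "rep (ae_class M g) \<in> borel_measurable M"
    using assms rep_sq_integrable sq_integrable_measurable by blast+
  have "AE x in M. rep (ae_class M f) x * cnj (rep (ae_class M g) x) = f x * cnj (g x)"
    using rep_ae_class[OF assms(1)] rep_ae_class[OF assms(2)] by eventually_elim simp
  then have "(LINT x|M. rep (ae_class M f) x * cnj (rep (ae_class M g) x))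
      = (LINT x|M. f x * cnj (g x))"
    by (intro integral_cong_AE) auto
  then show ?thesis by (simp add: L2_def)
qed

lemma abelian_group_L2: "abelian_group (L2 M)"
proof (rule abelian_groupI)
  fix F assume "F \<in> carrier (L2 M)"
  then obtain f where f: "f \<in> sq_integrable M" "F = ae_class M f" by (auto simp: carrier_L2)
  have "ae_class M (\<lambda>x. - 1 * f x) \<oplus>\<^bsub>L2 M\<^esub> F = \<zero>\<^bsub>L2 M\<^esub>"
    unfolding f(2) by (subst add_L2) (use f sq_integrable_scale[OF f(1), of "-1"] in \<open>auto simp: zero_L2\<close>)
  then show "\<exists>y\<in>carrier (L2 M). y \<oplus>\<^bsub>L2 M\<^esub> F = \<zero>\<^bsub>L2 M\<^esub>"
    using sq_integrable_scale[OF f(1), of "-1"] by (intro bexI) (auto simp: carrier_L2)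
qed (auto simp: carrier_L2 zero_L2 add_L2 sq_integrable_add sq_integrable_zero add_ac)

lemma complex_inner_space_L2: "complex_inner_space (L2 M)"
proof -
  interpret abelian_group "L2 M" by (rule abelian_group_L2)
  have int: "(LINT x|M. f x * cnj (f x)) = complex_of_real (LINT x|M. (cmod (f x))\<^sup>2)" for f
    by (simp add: complex_norm_square[symmetric] flip: integral_complex_of_real)
  show ?thesis
  proof
    fix F G K a assume FGK: "F \<in> carrier (L2 M)" "G \<in> carrier (L2 M)" "K \<in> carrier (L2 M)"
    then obtain f g k where fgk: "f \<in> sq_integrable M" "F = ae_class M f"
        "g \<in> sq_integrable M" "G = ae_class M g" "k \<in> sq_integrable M" "K = ae_class M k"
      by (auto simp: carrier_L2)
    show "vinner (L2 M) (F \<oplus>\<^bsub>L2 M\<^esub> G) K = vinner (L2 M) F K + vinner (L2 M) G K"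
      using fgk
      by (simp add: add_L2 vinner_L2 sq_integrable_add ring_distribs integrable_mult_cnj)
  next
    fix F G a assume FGK: "F \<in> carrier (L2 M)" "G \<in> carrier (L2 M)"
    then obtain f g where fg: "f \<in> sq_integrable M" "F = ae_class M f"
        "g \<in> sq_integrable M" "G = ae_class M g"
      by (auto simp: carrier_L2)
    show "vinner (L2 M) (a \<odot>\<^bsub>L2 M\<^esub> F) G = a * vinner (L2 M) F G"
      using fg by (simp add: smult_L2 vinner_L2 sq_integrable_scale mult.assoc)
    have "cnj (LINT x|M. f x * cnj (g x)) = (LINT x|M. g x * cnj (f x))"
      by (subst Bochner_Integration.integral_cnj[symmetric]) (simp add: mult.commute)
    then show "vinner (L2 M) G F = cnj (vinner (L2 M) F G)"
      using fg by (simp add: vinner_L2)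
  next
    fix F assume "F \<in> carrier (L2 M)"
    then obtain f where f: "f \<in> sq_integrable M" "F = ae_class M f" by (auto simp: carrier_L2)
    show "0 \<le> vinner (L2 M) F F"
      using f by (simp add: vinner_L2 int less_eq_complex_def)
    assume "vinner (L2 M) F F = 0"
    then have "(LINT x|M. (cmod (f x))\<^sup>2) = 0" using f by (simp add: vinner_L2 int)
    then have "AE x in M. f x = 0"
      using f by (subst (asm) integral_nonneg_eq_0_iff_AE) (auto simp: sq_integrable_def)
    then show "F = \<zero>\<^bsub>L2 M\<^esub>" unfolding f zero_L2 by (rule ae_class_cong)
  qed (auto simp: carrier_L2 add_L2 smult_L2 sq_integrable_add sq_integrable_scale ring_distribs
      mult.assoc)
qed

lemma hnorm_L2:
  assumes "f \<in> sq_integrable M"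
  shows "hnorm (L2 M) (ae_class M f) = sqrt (LINT x|M. (cmod (f x))\<^sup>2)"
proof -
  have "(LINT x|M. f x * cnj (f x)) = complex_of_real (LINT x|M. (cmod (f x))\<^sup>2)"
    by (simp add: complex_norm_square[symmetric] flip: integral_complex_of_real)
  then show ?thesis by (simp add: hnorm_def vinner_L2 assms)
qed

lemma diff_L2:
  assumes "f \<in> sq_integrable M" "g \<in> sq_integrable M"
  shows "ae_class M f \<ominus>\<^bsub>L2 M\<^esub> ae_class M g = ae_class M (\<lambda>x. f x - g x)"
proof -
  interpret abelian_group "L2 M" by (rule abelian_group_L2)
  have g': "(\<lambda>x. - 1 * g x) \<in> sq_integrable M" by (rule sq_integrable_scale[OF assms(2)])
  have "\<ominus>\<^bsub>L2 M\<^esub> ae_class M g = ae_class M (\<lambda>x. - 1 * g x)"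
    by (rule minus_equality) (use assms g' in \<open>auto simp: add_L2 zero_L2 carrier_L2\<close>)
  then show ?thesis using assms g' by (simp add: a_minus_def add_L2)
qed

lemma L2_complete_functions:
  fixes f :: "nat \<Rightarrow> 'a \<Rightarrow> complex"
  assumes f: "\<And>n. f n \<in> sq_integrable M"
    and cauchy: "\<And>e. 0 < e \<Longrightarrow>
      \<exists>N. \<forall>i\<ge>N. \<forall>j\<ge>N. (LINT x|M. (cmod (f i x - f j x))\<^sup>2) < e"
  obtains g where "g \<in> sq_integrable M"
    "(\<lambda>n. LINT x|M. (cmod (f n x - g x))\<^sup>2) \<longlonglongrightarrow> 0"
proof -
  define N where "N e = (SOME N. \<forall>i\<ge>N. \<forall>j\<ge>N. (LINT x|M. (cmod (f i x - f j x))\<^sup>2) < e)"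
    for e :: real
  have N: "(LINT x|M. (cmod (f i x - f j x))\<^sup>2) < e" if "0 < e" "i \<ge> N e" "j \<ge> N e" for e i j
    using someI_ex[OF cauchy[OF that(1)]] that unfolding N_def by blast
  define r where "r k = k + Max ((\<lambda>i. N ((1 / 4) ^ i)) ` {..k})" for k :: nat
  have r_ge: "N ((1 / 4) ^ k) \<le> r k" for k
    unfolding r_def by (intro trans_le_add2 Max_ge) auto
  have r_ge': "k \<le> r k" for k by (simp add: r_def)
  have r_mono: "r k \<le> r (Suc k)" for k
    unfolding r_def by (intro add_mono Max_mono) auto
  have [measurable]: "f n \<in> borel_measurable M" for n
    by (rule sq_integrable_measurable[OF f])
  have int: "integrable M (\<lambda>x. (cmod (f i x - f j x))\<^sup>2)" for i j
    using sq_integrable_diff[OF f f] by (simp add: sq_integrable_def)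
  define a where "a k x = (cmod (f (r (Suc k)) x - f (r k) x))\<^sup>2" for k x
  have [measurable]: "a k \<in> borel_measurable M" for k unfolding a_def by measurable
  have a_int: "(\<integral>\<^sup>+x. ennreal (2 ^ k * a k x) \<partial>M) \<le> ennreal ((1 / 2) ^ k)" for k
  proof -
    have "(LINT x|M. a k x) \<le> (1 / 4) ^ k"
      unfolding a_def using N[of "(1 / 4) ^ k" "r (Suc k)" "r k"] r_ge[of k] r_mono[of k] by simp
    then have "2 ^ k * (LINT x|M. a k x) \<le> 2 ^ k * (1 / 4) ^ k" by (intro mult_left_mono) auto
    also have "\<dots> = (1 / 2 :: real) ^ k" by (simp flip: power_mult_distrib)
    finally have "(LINT x|M. 2 ^ k * a k x) \<le> (1 / 2) ^ k" by simp
    moreover have "(\<integral>\<^sup>+x. ennreal (2 ^ k * a k x) \<partial>M) = ennreal (LINT x|M. 2 ^ k * a k x)"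
      using int by (intro nn_integral_eq_integral) (auto simp: a_def)
    ultimately show ?thesis by (simp add: ennreal_leI)
  qed
  have "(\<integral>\<^sup>+x. (\<Sum>k. ennreal (2 ^ k * a k x)) \<partial>M)
      = (\<Sum>k. \<integral>\<^sup>+x. ennreal (2 ^ k * a k x) \<partial>M)"
    by (rule nn_integral_suminf) measurable
  also have "\<dots> \<le> (\<Sum>k. ennreal ((1 / 2) ^ k))"
    by (intro suminf_le a_int) auto
  also have "\<dots> = ennreal (\<Sum>k. (1 / 2) ^ k)"
    by (intro suminf_ennreal2) (auto intro: summable_geometric)
  also have "\<dots> < \<infinity>" by simp
  finally have "(\<integral>\<^sup>+x. (\<Sum>k. ennreal (2 ^ k * a k x)) \<partial>M) \<noteq> \<infinity>" by simp
  then have "AE x in M. (\<Sum>k. ennreal (2 ^ k * a k x)) \<noteq> \<infinity>"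
    by (intro nn_integral_PInf_AE) measurable
  then have conv: "AE x in M. convergent (\<lambda>k. f (r k) x)"
  proof eventually_elim
    case (elim x)
    have "summable (\<lambda>k. 2 ^ k * a k x)"
      using elim by (intro summable_suminf_not_top) (auto simp: a_def)
    then have "(\<lambda>k. 2 ^ k * a k x) \<longlonglongrightarrow> 0" by (rule summable_LIMSEQ_zero)
    then have "eventually (\<lambda>k. 2 ^ k * a k x < 1) sequentially"
      by (rule order_tendstoD) simp
    then have "eventually (\<lambda>k. cmod (f (r (Suc k)) x - f (r k) x) \<le> sqrt (1 / 2) ^ k) sequentially"
    proof eventually_elim
      case (elim k)
      have "(cmod (f (r (Suc k)) x - f (r k) x))\<^sup>2 \<le> (1 / 2) ^ k"
        using elim by (simp add: a_def field_simps)
      then have "cmod (f (r (Suc k)) x - f (r k) x) \<le> sqrt ((1 / 2) ^ k)"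
        by (rule real_le_rsqrt)
      then show ?case by (simp add: real_sqrt_power)
    qed
    moreover have "summable (\<lambda>k. sqrt (1 / 2) ^ k)"
      by (rule summable_geometric) (simp add: real_sqrt_less_iff[of _ 1, simplified])
    ultimately have "summable (\<lambda>k. f (r (Suc k)) x - f (r k) x)"
      by (rule summable_comparison_test_ev)
    then have "convergent (\<lambda>n. \<Sum>k<n. f (r (Suc k)) x - f (r k) x)"
      by (simp add: summable_iff_convergent)
    then have "convergent (\<lambda>n. f (r n) x - f (r 0) x)"
      using sum_lessThan_telescope[of "\<lambda>k. f (r k) x"] by simp
    then have "convergent (\<lambda>n. (f (r n) x - f (r 0) x) + f (r 0) x)"
      by (intro convergent_add convergent_const)
    then show ?case by simp
  qed
  define g where "g x = lim (\<lambda>k. f (r k) x)" for x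
  have [measurable]: "g \<in> borel_measurable M" unfolding g_def by measurable
  have lim: "AE x in M. (\<lambda>k. f (r k) x) \<longlonglongrightarrow> g x"
    using conv by eventually_elim (simp add: g_def convergent_LIMSEQ_iff)
  have bound: "(\<integral>\<^sup>+x. ennreal ((cmod (f n x - g x))\<^sup>2) \<partial>M) \<le> ennreal e"
    if "0 < e" "n \<ge> N e" for e n
  proof -
    have "AE x in M. ennreal ((cmod (f n x - g x))\<^sup>2)
        = liminf (\<lambda>k. ennreal ((cmod (f n x - f (r k) x))\<^sup>2))"
      using lim
    proof eventually_elim
      case (elim x)
      have "(\<lambda>k. ennreal ((cmod (f n x - f (r k) x))\<^sup>2)) \<longlonglongrightarrow> ennreal ((cmod (f n x - g x))\<^sup>2)"
        using elim by (intro tendsto_ennrealI tendsto_intros)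
      then show ?case by (intro lim_imp_Liminf[symmetric] sequentially_bot)
    qed
    then have "(\<integral>\<^sup>+x. ennreal ((cmod (f n x - g x))\<^sup>2) \<partial>M)
        = (\<integral>\<^sup>+x. liminf (\<lambda>k. ennreal ((cmod (f n x - f (r k) x))\<^sup>2)) \<partial>M)"
      by (rule nn_integral_cong_AE)
    also have "\<dots> \<le> liminf (\<lambda>k. \<integral>\<^sup>+x. ennreal ((cmod (f n x - f (r k) x))\<^sup>2) \<partial>M)"
      by (rule nn_integral_liminf) measurable
    also have "\<dots> \<le> liminf (\<lambda>k::nat. ennreal e)"
    proof (rule Liminf_mono)
      show "\<forall>\<^sub>F k in sequentially. (\<integral>\<^sup>+x. ennreal ((cmod (f n x - f (r k) x))\<^sup>2) \<partial>M) \<le> ennreal e"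
        using eventually_ge_at_top[of "N e"]
      proof eventually_elim
        case (elim k)
        have "(\<integral>\<^sup>+x. ennreal ((cmod (f n x - f (r k) x))\<^sup>2) \<partial>M)
            = ennreal (LINT x|M. (cmod (f n x - f (r k) x))\<^sup>2)"
          using int by (intro nn_integral_eq_integral) auto
        also have "\<dots> \<le> ennreal e"
          using N[OF that(1) that(2), of "r k"] elim r_ge'[of k] by (intro ennreal_leI) auto
        finally show ?case .
      qed
    qed
    also have "\<dots> = ennreal e" by (simp add: Liminf_const)
    finally show ?thesis .
  qed
  have diff: "(\<lambda>x. f n x - g x) \<in> sq_integrable M" if "n \<ge> N 1" for n
  proof -
    have "integrable M (\<lambda>x. (cmod (f n x - g x))\<^sup>2)"
      using bound[of 1 n] that
      by (intro integrableI_nonneg) (auto simp: order.strict_trans1)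
    then show ?thesis by (simp add: sq_integrable_def)
  qed
  have "(\<lambda>x. f (N 1) x - (f (N 1) x - g x)) \<in> sq_integrable M"
    by (intro sq_integrable_diff f diff) simp
  then have g: "g \<in> sq_integrable M" by simp
  have "(\<lambda>n. LINT x|M. (cmod (f n x - g x))\<^sup>2) \<longlonglongrightarrow> 0"
  proof (rule LIMSEQ_I)
    fix e :: real assume e: "0 < e"
    have "norm ((LINT x|M. (cmod (f n x - g x))\<^sup>2) - 0) < e" if "n \<ge> N (e / 2)" for n
    proof -
      have "ennreal (LINT x|M. (cmod (f n x - g x))\<^sup>2)
          = (\<integral>\<^sup>+x. ennreal ((cmod (f n x - g x))\<^sup>2) \<partial>M)"
        using sq_integrable_diff[OF f g]
        by (intro nn_integral_eq_integral[symmetric]) (auto simp: sq_integrable_def)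
      also have "\<dots> \<le> ennreal (e / 2)" using bound[of "e / 2" n] e that by simp
      finally show ?thesis using e by (simp add: ennreal_le_iff)
    qed
    then show "\<exists>no. \<forall>n\<ge>no. norm ((LINT x|M. (cmod (f n x - g x))\<^sup>2) - 0) < e" by blast
  qed
  with g show ?thesis by (rule that)
qed

theorem complex_hilbert_space_L2:
  fixes M :: "'a measure"
  shows "complex_hilbert_space (L2 M)"
proof -
  interpret complex_inner_space "L2 M" by (rule complex_inner_space_L2)
  show ?thesis
  proof
    fix X :: "nat \<Rightarrow> ('a \<Rightarrow> complex) set" assume X: "\<And>n. X n \<in> carrier (L2 M)"
      and cauchy: "\<And>e. 0 < e \<Longrightarrow>
        \<exists>N. \<forall>i\<ge>N. \<forall>j\<ge>N. hnorm (L2 M) (X i \<ominus>\<^bsub>L2 M\<^esub> X j) < e"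
    have "\<exists>f. f \<in> sq_integrable M \<and> X n = ae_class M f" for n
      using X[of n] by (auto simp: carrier_L2)
    then obtain f where f: "\<And>n. f n \<in> sq_integrable M" "\<And>n. X n = ae_class M (f n)"
      by metis
    have c: "\<exists>N. \<forall>i\<ge>N. \<forall>j\<ge>N. (LINT x|M. (cmod (f i x - f j x))\<^sup>2) < e" if "0 < e" for e
      using cauchy[of "sqrt e"] that f by (simp add: diff_L2 hnorm_L2 sq_integrable_diff)
    obtain g where g: "g \<in> sq_integrable M"
      "(\<lambda>n. LINT x|M. (cmod (f n x - g x))\<^sup>2) \<longlonglongrightarrow> 0"
      by (rule L2_complete_functions[of f M]) (use f(1) c in auto)
    have "(\<lambda>n. hnorm (L2 M) (X n \<ominus>\<^bsub>L2 M\<^esub> ae_class M g)) \<longlonglongrightarrow> 0"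
      using tendsto_real_sqrt[OF g(2)] f g(1) by (simp add: diff_L2 hnorm_L2 sq_integrable_diff)
    then show "\<exists>x\<in>carrier (L2 M). (\<lambda>n. hnorm (L2 M) (X n \<ominus>\<^bsub>L2 M\<^esub> x)) \<longlonglongrightarrow> 0"
      using g(1) by (intro bexI) (auto simp: carrier_L2)
  qed
qed

end

theory Submission
  imports Defs
begin

text \<open>
  For \<open>T = M_u\<close> on \<open>L\<^sup>2(\<mu>)\<close> the adjoint is multiplication by \<open>cnj u\<close>, so by the binomial
  theorem \<open>B_m\<close> and \<open>T\<^sup>* B_m T\<close> are multiplication by \<open>(\<bar>u\<bar>\<^sup>2 - 1)^m\<close> and
  \<open>\<bar>u\<bar>\<^sup>2 (\<bar>u\<bar>\<^sup>2 - 1)^m\<close>. Testing against indicators of sets of finite measure shows that,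
  over a semifinite measure, multiplication by \<open>v\<close> vanishes only if \<open>v = 0\<close> almost everywhere.
\<close>

section \<open>Functions acting on L^2 by multiplication\<close>

definition L2_multiplier :: "'a measure \<Rightarrow> ('a \<Rightarrow> complex) \<Rightarrow> bool" where
  "L2_multiplier M u \<longleftrightarrow>
     u \<in> borel_measurable M \<and> (\<forall>f\<in>sq_integrable M. (\<lambda>x. u x * f x) \<in> sq_integrable M)"

lemma L2_multiplier_measurable: "L2_multiplier M u \<Longrightarrow> u \<in> borel_measurable M"
  by (simp add: L2_multiplier_def)

lemma sq_integrable_multiplier:
  "L2_multiplier M u \<Longrightarrow> f \<in> sq_integrable M \<Longrightarrow> (\<lambda>x. u x * f x) \<in> sq_integrable M"
  by (simp add: L2_multiplier_def)

lemma L2_multiplier_cnj: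
  assumes "L2_multiplier M u"
  shows "L2_multiplier M (\<lambda>x. cnj (u x))"
  unfolding L2_multiplier_def
proof (intro conjI ballI)
  have [measurable]: "u \<in> borel_measurable M"
    using assms by (rule L2_multiplier_measurable)
  show "(\<lambda>x. cnj (u x)) \<in> borel_measurable M"
    by measurable
  fix f assume f: "f \<in> sq_integrable M"
  then have [measurable]: "f \<in> borel_measurable M"
    by (rule sq_integrable_measurable)
  show "(\<lambda>x. cnj (u x) * f x) \<in> sq_integrable M"
    using sq_integrable_multiplier[OF assms f] by (simp add: sq_integrable_def norm_mult)
qed

lemma L2_multiplier_power:
  assumes "L2_multiplier M u" "f \<in> sq_integrable M"
  shows "(\<lambda>x. u x ^ k * f x) \<in> sq_integrable M"
proof (induction k)
  case (Suc k)
  then show ?case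
    using sq_integrable_multiplier[OF assms(1) Suc.IH] by (simp add: mult.assoc)
qed (simp add: assms)

lemma mult_operator_ae_class:
  assumes "f \<in> sq_integrable M"
  shows "mult_operator M u (ae_class M f) = ae_class M (\<lambda>x. u x * f x)"
  unfolding mult_operator_def
  by (rule ae_class_cong) (use rep_ae_class[OF assms] in \<open>auto elim: eventually_mono\<close>)

text \<open>\<open>ae_class\<close> is empty on functions not a.e. equal to a square-integrable one,
  whereas every element of the carrier is nonempty. Since the operator maps into the carrier,
  \<open>u * f\<close> agrees a.e. with a square-integrable function and, being measurable, is
  square-integrable itself. This passes from classes to functions.\<close>

lemma bounded_mult_operator_multiplier:
  assumes "bounded_operator (L2 M) (mult_operator M u)" "u \<in> borel_measurable M"
  shows "L2_multiplier M u"
  unfolding L2_multiplier_def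
proof (intro conjI ballI assms(2))
  fix f assume f: "f \<in> sq_integrable M"
  have [measurable]: "u \<in> borel_measurable M" "f \<in> borel_measurable M"
    using assms(2) f by (auto simp: sq_integrable_def)
  have "mult_operator M u (ae_class M f) \<in> carrier (L2 M)"
    using assms(1) f unfolding bounded_operator_def carrier_L2 by blast
  then obtain g where g: "g \<in> sq_integrable M"
    and eq: "ae_class M (\<lambda>x. u x * f x) = ae_class M g"
    unfolding mult_operator_ae_class[OF f] carrier_L2 by blast
  have [measurable]: "g \<in> borel_measurable M"
    using g by (rule sq_integrable_measurable)
  \<comment> \<open>\<open>ae_class_eq_iff\<close> would presuppose the goal that
    \<open>u * f\<close> is square-integrable. The a.e. equality is instead read off from the
    membership of \<open>g\<close> in both classes.\<close>
  have "g \<in> ae_class M g"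
    using g by (simp add: ae_class_def)
  then have "AE x in M. g x = u x * f x"
    unfolding eq[symmetric] by (simp add: ae_class_def)
  then have "AE x in M. (cmod (u x * f x))\<^sup>2 = (cmod (g x))\<^sup>2"
    by eventually_elim simp
  then have "integrable M (\<lambda>x. (cmod (u x * f x))\<^sup>2)"
    using g by (subst integrable_cong_AE) (auto simp: sq_integrable_def)
  then show "(\<lambda>x. u x * f x) \<in> sq_integrable M"
    by (simp add: sq_integrable_def)
qed

section \<open>The adjoint of a multiplication operator\<close>

lemma vinner_L2_ext:
  assumes f: "f \<in> sq_integrable M" and g: "g \<in> sq_integrable M"
    and eq: "\<And>h. h \<in> sq_integrable M \<Longrightarrow>
      (LINT x|M. h x * cnj (f x)) = (LINT x|M. h x * cnj (g x))"
  shows "ae_class M f = ae_class M g"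
proof -
  \<comment> \<open>Testing against the difference of the two functions makes its squared norm
    vanish.\<close>
  define h where "h = (\<lambda>x. f x - g x)"
  have h: "h \<in> sq_integrable M"
    unfolding h_def by (intro sq_integrable_diff f g)
  have "(LINT x|M. h x * cnj (h x)) = (LINT x|M. h x * cnj (f x) - h x * cnj (g x))"
    by (simp add: h_def algebra_simps)
  also have "\<dots> = 0"
    using eq[OF h] by (simp add: integrable_mult_cnj h f g)
  finally have "complex_of_real (LINT x|M. (cmod (h x))\<^sup>2) = 0"
    by (simp add: complex_norm_square[symmetric] flip: integral_complex_of_real)
  then have "AE x in M. h x = 0"
    using h by (simp add: sq_integrable_def integral_nonneg_eq_0_iff_AE)
  then show ?thesis
    by (intro ae_class_cong) (simp add: h_def)
qed

text \<open>Moving \<open>u\<close> to the second argument of the inner product conjugates it, which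
  gives a candidate for the adjoint; \<open>vinner_L2_ext\<close> gives the uniqueness that the
  definite description demands.\<close>

lemma hadjoint_mult_operator:
  assumes u: "L2_multiplier M u" and f: "f \<in> sq_integrable M"
  shows "hadjoint (L2 M) (mult_operator M u) (ae_class M f) = ae_class M (\<lambda>x. cnj (u x) * f x)"
  unfolding hadjoint_def
proof (rule the_equality)
  let ?g = "\<lambda>x. cnj (u x) * f x"
  have g: "?g \<in> sq_integrable M"
    by (rule sq_integrable_multiplier[OF L2_multiplier_cnj[OF u] f])
  have inner: "vinner (L2 M) (mult_operator M u (ae_class M h)) (ae_class M f)
      = (LINT x|M. h x * cnj (?g x))" if "h \<in> sq_integrable M" for h
    using that f sq_integrable_multiplier[OF u that]
    by (simp add: mult_operator_ae_class vinner_L2 ac_simps)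
  show "ae_class M ?g \<in> carrier (L2 M) \<and> (\<forall>x\<in>carrier (L2 M).
      vinner (L2 M) (mult_operator M u x) (ae_class M f) = vinner (L2 M) x (ae_class M ?g))"
    using g by (auto simp: carrier_L2 inner vinner_L2)
  fix Z assume Z: "Z \<in> carrier (L2 M) \<and> (\<forall>x\<in>carrier (L2 M).
      vinner (L2 M) (mult_operator M u x) (ae_class M f) = vinner (L2 M) x Z)"
  then obtain z where z: "z \<in> sq_integrable M" "Z = ae_class M z"
    by (auto simp: carrier_L2)
  show "Z = ae_class M ?g"
    unfolding z(2) using Z z by (intro vinner_L2_ext g) (auto simp: carrier_L2 inner vinner_L2)
qed

section \<open>The isometry defect as a multiplication operator\<close>

lemma mult_operator_funpow:
  assumes "L2_multiplier M u" "f \<in> sq_integrable M"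
  shows "(mult_operator M u ^^ k) (ae_class M f) = ae_class M (\<lambda>x. u x ^ k * f x)"
  by (induction k) (simp_all add: mult_operator_ae_class L2_multiplier_power assms mult.assoc)

lemma hadjoint_mult_operator_funpow:
  assumes "L2_multiplier M u" "f \<in> sq_integrable M"
  shows "(hadjoint (L2 M) (mult_operator M u) ^^ k) (ae_class M f)
    = ae_class M (\<lambda>x. cnj (u x) ^ k * f x)"
  by (induction k)
    (simp_all add: hadjoint_mult_operator L2_multiplier_power L2_multiplier_cnj assms mult.assoc)

text \<open>Square integrability is part of the conclusion because \<open>add_L2\<close> requires it
  of the partial sum in the induction step.\<close>

lemma finsum_L2:
  assumes "finite I" "\<And>i. i \<in> I \<Longrightarrow> f i \<in> sq_integrable M"
  shows "(\<lambda>x. \<Sum>i\<in>I. f i x) \<in> sq_integrable M \<and>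
    (\<Oplus>\<^bsub>L2 M\<^esub>i\<in>I. ae_class M (f i)) = ae_class M (\<lambda>x. \<Sum>i\<in>I. f i x)"
proof -
  interpret abelian_group "L2 M" by (rule abelian_group_L2)
  show ?thesis
    using assms
  proof (induction I rule: finite_induct)
    case empty
    show ?case by (simp add: sq_integrable_zero zero_L2)
  next
    case (insert i I)
    then have fi: "f i \<in> sq_integrable M" and fI: "(\<lambda>x. \<Sum>j\<in>I. f j x) \<in> sq_integrable M"
      and eq: "(\<Oplus>\<^bsub>L2 M\<^esub>j\<in>I. ae_class M (f j)) = ae_class M (\<lambda>x. \<Sum>j\<in>I. f j x)"
      by auto
    have "(\<Oplus>\<^bsub>L2 M\<^esub>j\<in>insert i I. ae_class M (f j))
        = ae_class M (f i) \<oplus>\<^bsub>L2 M\<^esub> (\<Oplus>\<^bsub>L2 M\<^esub>j\<in>I. ae_class M (f j))"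
      using insert.hyps insert.prems by (intro finsum_insert) (auto simp: carrier_L2)
    then show ?case
      using insert.hyps fi fI by (simp add: eq add_L2 sq_integrable_add)
  qed
qed

text \<open>Used over the complex numbers for the coefficients of the defect and over the reals for
  the sums in the final theorem, hence the general ring.\<close>

lemma binomial_minus_one:
  fixes a :: "'a::comm_ring_1"
  shows "(\<Sum>k\<le>m. (-1) ^ (m - k) * of_nat (m choose k) * a ^ k) = (a - 1) ^ m"
  using binomial_ring[of a "-1" m] by (simp add: mult_ac)

text \<open>The summand of index \<open>k\<close> multiplies by a scalar times |u|^(2k), so the
  binomial theorem sums the multipliers pointwise. As a finite sum of square-integrable functions,
  \<open>v * f\<close> is square-integrable.\<close>

lemma isometry_defect_mult_operator:
  fixes m :: nat
  assumes u: "L2_multiplier M u" and f: "f \<in> sq_integrable M"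
  defines "v \<equiv> \<lambda>x. of_real (((cmod (u x))\<^sup>2 - 1) ^ m)"
  shows "(\<lambda>x. v x * f x) \<in> sq_integrable M"
    and "isometry_defect (L2 M) (mult_operator M u) m (ae_class M f) = ae_class M (\<lambda>x. v x * f x)"
proof -
  define c :: "nat \<Rightarrow> complex" where "c k = (-1) ^ (m - k) * of_nat (m choose k)" for k
  define g where "g k x = c k * (cnj (u x) ^ k * (u x ^ k * f x))" for k x
  have g: "g k \<in> sq_integrable M" for k
    unfolding g_def
    by (intro sq_integrable_scale L2_multiplier_power L2_multiplier_cnj u f)
  have term_eq: "c k \<odot>\<^bsub>L2 M\<^esub> (hadjoint (L2 M) (mult_operator M u) ^^ k)
      ((mult_operator M u ^^ k) (ae_class M f)) = ae_class M (g k)" for k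
    by (simp add: mult_operator_funpow hadjoint_mult_operator_funpow L2_multiplier_power
        L2_multiplier_cnj u f smult_L2 g_def[abs_def])
  have "(\<Sum>k\<le>m. g k x) = v x * f x" for x
  proof -
    have "g k x = (-1) ^ (m - k) * of_nat (m choose k) * complex_of_real ((cmod (u x))\<^sup>2) ^ k * f x" for k
      \<comment> \<open>The k-th powers of \<open>cnj (u x)\<close> and \<open>u x\<close> combine
        to the k-th power of |u|^2.\<close>
      unfolding complex_norm_square g_def c_def by (simp add: power_mult_distrib mult_ac)
    then have "(\<Sum>k\<le>m. g k x)
        = (\<Sum>k\<le>m. (-1) ^ (m - k) * of_nat (m choose k) * complex_of_real ((cmod (u x))\<^sup>2) ^ k) * f x"
      by (simp add: sum_distrib_right)
    also have "\<dots> = v x * f x"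
      by (simp add: binomial_minus_one v_def)
    finally show ?thesis .
  qed
  then have sum: "(\<lambda>x. \<Sum>k\<le>m. g k x) = (\<lambda>x. v x * f x)"
    by (rule ext)
  show "(\<lambda>x. v x * f x) \<in> sq_integrable M"
    and "isometry_defect (L2 M) (mult_operator M u) m (ae_class M f) = ae_class M (\<lambda>x. v x * f x)"
    using finsum_L2[of "{..m}" g M] g
    by (simp_all add: sum isometry_defect_def term_eq flip: c_def)
qed

section \<open>Vanishing multipliers over semifinite measures\<close>

lemma AE_zero_if_annihilates_L2:
  assumes semi: "semifinite M" and v [measurable]: "v \<in> borel_measurable M"
    and zero: "\<And>f. f \<in> sq_integrable M \<Longrightarrow> AE x in M. v x * f x = 0"
  shows "AE x in M. v x = 0"
proof -
  define A where "A = {x \<in> space M. v x \<noteq> 0}"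
  have A [measurable]: "A \<in> sets M"
    unfolding A_def by measurable
  \<comment> \<open>The indicator of a set of finite measure is an admissible test function. Its
    product with \<open>v\<close> is nonzero at every point of \<open>B\<close>, yet vanishes
    a.e.\<close>
  have null: "emeasure M B = 0" if B: "B \<in> sets M" "B \<subseteq> A" "emeasure M B < \<infinity>" for B
  proof -
    have "(\<lambda>x. (cmod (indicator B x))\<^sup>2) = (indicator B :: 'a \<Rightarrow> real)"
      by (auto simp: indicator_def)
    then have "(indicator B :: 'a \<Rightarrow> complex) \<in> sq_integrable M"
      using B by (simp add: sq_integrable_def)
    then have "AE x in M. v x * indicator B x = 0"
      by (rule zero)
    then have "AE x in M. x \<notin> B"
      using B(2) by (auto elim!: eventually_mono simp: A_def indicator_def split: if_splits)
    then show ?thesis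
      using B(1) by (simp add: AE_iff_null_sets null_setsD1)
  qed
  \<comment> \<open>Semifiniteness would otherwise yield a subset of \<open>A\<close> of positive
    finite measure, contradicting \<open>null\<close>. Afterwards \<open>null\<close> applies to
    \<open>A\<close> itself.\<close>
  have "emeasure M A < \<infinity>"
  proof (rule ccontr)
    assume "\<not> emeasure M A < \<infinity>"
    then have "emeasure M A = \<infinity>"
      by (simp add: less_top[symmetric])
    then obtain B where "B \<in> sets M" "B \<subseteq> A" "0 < emeasure M B" "emeasure M B < \<infinity>"
      using semi A unfolding semifinite_def by blast
    then show False
      using null[of B] by simp
  qed
  then have "emeasure M A = 0"
    by (intro null) auto
  then have "A \<in> null_sets M"
    using A by (rule null_setsI)
  then have "AE x in M. x \<notin> A"
    by (rule AE_not_in)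
  then show ?thesis
    using AE_space by eventually_elim (simp add: A_def)
qed

lemma ae_class_mult_eq_zero_iff:
  assumes "semifinite M" "v \<in> borel_measurable M"
    and "\<And>f. f \<in> sq_integrable M \<Longrightarrow> (\<lambda>x. v x * f x) \<in> sq_integrable M"
  shows "(\<forall>f\<in>sq_integrable M. ae_class M (\<lambda>x. v x * f x) = \<zero>\<^bsub>L2 M\<^esub>) \<longleftrightarrow> (AE x in M. v x = 0)"
proof -
  have "(\<forall>f\<in>sq_integrable M. ae_class M (\<lambda>x. v x * f x) = \<zero>\<^bsub>L2 M\<^esub>)
      \<longleftrightarrow> (\<forall>f\<in>sq_integrable M. AE x in M. v x * f x = 0)"
    by (simp add: zero_L2 ae_class_eq_iff assms(3) sq_integrable_zero)
  also have "\<dots> \<longleftrightarrow> (AE x in M. v x = 0)"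
    using AE_zero_if_annihilates_L2[OF assms(1,2)] by (auto elim: eventually_mono)
  finally show ?thesis .
qed

section \<open>Characterisation by a.e. equations for |u|\<close>

lemma m_isometry_mult_operator_iff:
  assumes semi: "semifinite M" and [measurable]: "u \<in> borel_measurable M"
    and bdd: "bounded_operator (L2 M) (mult_operator M u)"
  shows "m_isometry (L2 M) (mult_operator M u) m
    \<longleftrightarrow> (AE x in M. ((cmod (u x))\<^sup>2 - 1) ^ m = 0)"
proof -
  have u: "L2_multiplier M u"
    using bdd assms(2) by (rule bounded_mult_operator_multiplier)
  define v :: "'a \<Rightarrow> complex" where "v x = of_real (((cmod (u x))\<^sup>2 - 1) ^ m)" for x
  have [measurable]: "v \<in> borel_measurable M"
    unfolding v_def by measurable
  have "m_isometry (L2 M) (mult_operator M u) m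
      \<longleftrightarrow> (\<forall>f\<in>sq_integrable M. ae_class M (\<lambda>x. v x * f x) = \<zero>\<^bsub>L2 M\<^esub>)"
    using bdd by (simp add: m_isometry_def carrier_L2 isometry_defect_mult_operator[OF u] v_def)
  also have "\<dots> \<longleftrightarrow> (AE x in M. v x = 0)"
    using isometry_defect_mult_operator(1)[OF u]
    by (intro ae_class_mult_eq_zero_iff semi) (auto simp: v_def)
  finally show ?thesis
    by (simp only: v_def of_real_eq_0_iff)
qed

lemma quasi_m_isometry_mult_operator_iff:
  assumes semi: "semifinite M" and [measurable]: "u \<in> borel_measurable M"
    and bdd: "bounded_operator (L2 M) (mult_operator M u)"
  shows "quasi_m_isometry (L2 M) (mult_operator M u) m
    \<longleftrightarrow> (AE x in M. (cmod (u x))\<^sup>2 * ((cmod (u x))\<^sup>2 - 1) ^ m = 0)"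
proof -
  have u: "L2_multiplier M u"
    using bdd assms(2) by (rule bounded_mult_operator_multiplier)
  define w :: "'a \<Rightarrow> complex" where "w x = of_real (((cmod (u x))\<^sup>2 - 1) ^ m)" for x
  define v :: "'a \<Rightarrow> complex"
    where "v x = of_real ((cmod (u x))\<^sup>2 * ((cmod (u x))\<^sup>2 - 1) ^ m)" for x
  have [measurable]: "v \<in> borel_measurable M"
    unfolding v_def by measurable
  \<comment> \<open>From the inside out, the factors come from the operator, its defect and its
    adjoint; the outer two multiply to |u|^2.\<close>
  have v_eq: "cnj (u x) * (w x * (u x * f x)) = v x * f x" for f x
  proof -
    have "v x = of_real ((cmod (u x))\<^sup>2) * w x"
      by (simp add: v_def w_def)
    then show ?thesis
      by (simp only: complex_norm_square mult_ac)
  qed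
  have sq: "(\<lambda>x. w x * (u x * f x)) \<in> sq_integrable M" if "f \<in> sq_integrable M" for f
    unfolding w_def
    by (rule isometry_defect_mult_operator(1)[OF u sq_integrable_multiplier[OF u that]])
  have "hadjoint (L2 M) (mult_operator M u)
      (isometry_defect (L2 M) (mult_operator M u) m (mult_operator M u (ae_class M f)))
      = ae_class M (\<lambda>x. v x * f x)" if f: "f \<in> sq_integrable M" for f
  proof -
    have "isometry_defect (L2 M) (mult_operator M u) m (mult_operator M u (ae_class M f))
        = ae_class M (\<lambda>x. w x * (u x * f x))"
      unfolding mult_operator_ae_class[OF f] w_def
      by (rule isometry_defect_mult_operator(2)[OF u sq_integrable_multiplier[OF u f]])
    then show ?thesis
      by (simp add: hadjoint_mult_operator[OF u sq[OF f]] v_eq)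
  qed
  then have "quasi_m_isometry (L2 M) (mult_operator M u) m
      \<longleftrightarrow> (\<forall>f\<in>sq_integrable M. ae_class M (\<lambda>x. v x * f x) = \<zero>\<^bsub>L2 M\<^esub>)"
    using bdd by (simp add: quasi_m_isometry_def carrier_L2)
  also have "\<dots> \<longleftrightarrow> (AE x in M. v x = 0)"
  proof (intro ae_class_mult_eq_zero_iff semi)
    fix f assume "f \<in> sq_integrable M"
    \<comment> \<open>Applying the multipliers \<open>u\<close>, \<open>w\<close> and
      \<open>cnj u\<close> one after another stays within the square-integrable functions.\<close>
    from sq_integrable_multiplier[OF L2_multiplier_cnj[OF u] sq[OF this]]
    show "(\<lambda>x. v x * f x) \<in> sq_integrable M"
      by (simp only: v_eq)
  qed measurable
  finally show ?thesis
    by (simp only: v_def of_real_eq_0_iff)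
qed

theorem corollary2p3:
  fixes M :: "'a measure" and u :: "'a \<Rightarrow> complex" and m :: nat
  assumes "semifinite M"
    and "u \<in> borel_measurable M"
    and "\<And>x. x \<in> space M \<Longrightarrow> 0 \<le> u x"
    and "bounded_operator (L2 M) (mult_operator M u)"
    and "1 \<le> m"
  shows
    "(quasi_m_isometry (L2 M) (mult_operator M u) m \<longleftrightarrow>
        (AE x in M.
           (cmod (u x))\<^sup>2 * ((cmod (u x))\<^sup>2 - 1) ^ m =
             (\<Sum>k=0..m. (-1) ^ (m - k) * real (m choose k) * cmod (u x) ^ (2 * (k + 1))) \<and>
           (\<Sum>k=0..m. (-1) ^ (m - k) * real (m choose k) * cmod (u x) ^ (2 * (k + 1))) = 0)) \<and>
     (quasi_m_isometry (L2 M) (mult_operator M u) m \<longleftrightarrow>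
        (AE x in M. cmod (u x) * (1 - (cmod (u x))\<^sup>2) = 0)) \<and>
     (quasi_m_isometry (L2 M) (mult_operator M u) m \<longleftrightarrow>
        emeasure M ({x \<in> space M. u x \<noteq> 0} \<inter> {x \<in> space M. cmod (u x) \<noteq> 1}) = 0) \<and>
     (m_isometry (L2 M) (mult_operator M u) m \<longleftrightarrow>
        (AE x in M.
           ((cmod (u x))\<^sup>2 - 1) ^ m =
             (\<Sum>k=0..m. (-1) ^ (m - k) * real (m choose k) * cmod (u x) ^ (2 * k)) \<and>
           (\<Sum>k=0..m. (-1) ^ (m - k) * real (m choose k) * cmod (u x) ^ (2 * k)) = 0)) \<and>
     (m_isometry (L2 M) (mult_operator M u) m \<longleftrightarrow> (AE x in M. cmod (u x) = 1))"
proof -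
  note [measurable] = assms(2)
  \<comment> \<open>For exponent 0 the power would be the constant 1; a positive exponent makes a
    power vanish exactly when its base does.\<close>
  have m: "0 < m"
    using assms(5) by simp
  have binom: "(\<Sum>k=0..m. (-1) ^ (m - k) * real (m choose k) * a ^ (2 * k)) = (a\<^sup>2 - 1) ^ m"
    for a :: real
    using binomial_minus_one[of m "a\<^sup>2"] by (simp add: power_mult atMost_atLeast0)
  have qbinom: "(\<Sum>k=0..m. (-1) ^ (m - k) * real (m choose k) * a ^ (2 * (k + 1)))
      = a\<^sup>2 * (a\<^sup>2 - 1) ^ m" for a :: real
    unfolding binom[symmetric] by (simp add: sum_distrib_left power_add power2_eq_square mult_ac)
  \<comment> \<open>Nonnegativity excludes the root -1.\<close>
  have unit: "a\<^sup>2 = 1 \<longleftrightarrow> a = 1" if "0 \<le> a" for a :: real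
    using that by (auto simp: power2_eq_1_iff)
  \<comment> \<open>The set is rewritten as the exceptional set of a predicate, the form in which
    \<open>AE_iff_measurable\<close> turns null measure into a.e. validity.\<close>
  have "{x \<in> space M. u x \<noteq> 0} \<inter> {x \<in> space M. cmod (u x) \<noteq> 1}
      = {x \<in> space M. \<not> (u x = 0 \<or> cmod (u x) = 1)}"
    by auto
  then have null: "emeasure M ({x \<in> space M. u x \<noteq> 0} \<inter> {x \<in> space M. cmod (u x) \<noteq> 1}) = 0
      \<longleftrightarrow> (AE x in M. u x = 0 \<or> cmod (u x) = 1)"
    by (simp only:) (subst AE_iff_measurable[OF _ refl], measurable)
  have zero: "1 - (cmod (u x))\<^sup>2 = 0 \<longleftrightarrow> cmod (u x) = 1" for x
    using unit[of "cmod (u x)"] by auto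
  \<comment> \<open>After the rewriting, each equivalence compares two a.e. conditions that agree
    pointwise, and the polynomial identities inside them become reflexive.\<close>
  show ?thesis
    unfolding binom qbinom null m_isometry_mult_operator_iff[OF assms(1,2,4)]
      quasi_m_isometry_mult_operator_iff[OF assms(1,2,4)]
    using m by (simp add: unit zero)
qed

end
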